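(* For $A\in\mathbb{C}^{d\times d}$ and $m\in\mathbb{N}$ the following are equivalent: (i) $A$ is moving-average-stable for window width $m$. (ii) $\sigma(\mathcal{M}_m(A))\subseteq B_1(0)$. (iii) $\sigma(A)\subseteq \mathrm{MARS}_m$.
   Context: $\mathbb{N}=\{1,2,\dots\}$, $\mathbb{N}_0=\{0,1,2,\dots\}$; $\sigma(\cdot)$ denotes the spectrum (set of eigenvalues) of a square complex matrix; $B_1(0)=\{z\in\mathbb{C} : |z|<1\}$. $A\in\mathbb{C}^{d\times d}$ is called moving-average-stable for window width $m$ if every sequence $(x_k)_{k\in\mathbb{N}_0}$ in $\mathbb{C}^d$ which eventually (i.e. for all $k\ge k_0$, for some $k_0\ge m-1$) satisfies $$x_{k+1}=A\Bigl(\frac1m\sum_{\ell=0}^{m-1}x_{k-\ell}\Bigr)$$ converges to $0$. For $A\in\mathbb{C}^{d\times d}$, $\mathcal{M}_m(A)\in\mathbb{C}^{(md)\times(md)}$ is the block matrix consisting of $m\times m$ blocks of size $d\times d$ such that, for $1\le i\le m-1$, the $i$-th block row has the identity $I_d$ in block column $i+1$ and zeros elsewhere, and all blocks in the last ($m$-th) block row are equal to $\frac1m A$. For a scalar $a\in\mathbb{C}$, $\mathcal{M}_m(a)\in\mathbb{C}^{m\times m}$ is the case $d=1$. $\mathrm{MARS}_m:=\{a\in\mathbb{C} : \sigma(\mathcal{M}_m(a))\subseteq B_1(0)\}$. *)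

theory Defs
  imports
    "Jordan_Normal_Form.Spectral_Radius"
    "HOL-Analysis.L2_Norm"
    "HOL-Analysis.Elementary_Metric_Spaces"
begin

text \<open>The type \<open>vec\<close> carries no topology; convergence is in the Euclidean norm.\<close>

definition vec_converges_to_zero :: "(nat \<Rightarrow> complex vec) \<Rightarrow> bool" where
  "vec_converges_to_zero x \<longleftrightarrow>
     (\<lambda>k. L2_set (\<lambda>i. norm (x k $ i)) {..<dim_vec (x k)}) \<longlonglongrightarrow> 0"

definition moving_average :: "nat \<Rightarrow> nat \<Rightarrow> (nat \<Rightarrow> complex vec) \<Rightarrow> nat \<Rightarrow> complex vec" where
  "moving_average d m x k =
     (1 / of_nat m) \<cdot>\<^sub>v finsum_vec TYPE(complex) d (\<lambda>l. x (k - l)) {..<m}"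

text \<open>The bound \<open>m - 1 \<le> k0\<close> ensures that no subtraction \<open>k - l\<close> in the moving average is truncated.\<close>

definition moving_average_stable :: "nat \<Rightarrow> complex mat \<Rightarrow> bool" where
  "moving_average_stable m A \<longleftrightarrow>
     (\<forall>x. (\<forall>k. x k \<in> carrier_vec (dim_row A)) \<longrightarrow>
          (\<exists>k0 \<ge> m - 1. \<forall>k \<ge> k0. x (k + 1) = A *\<^sub>v moving_average (dim_row A) m x k) \<longrightarrow>
          vec_converges_to_zero x)"

text \<open>Block indices start at 0, so the last block row has index \<open>m - 1\<close>.\<close>

definition MA_block :: "nat \<Rightarrow> complex mat \<Rightarrow> nat \<Rightarrow> nat \<Rightarrow> complex mat" where
  "MA_block m A i j =
     (let d = dim_row A in
      if i < m - 1 then (if j = i + 1 then 1\<^sub>m d else 0\<^sub>m d d)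
      else (1 / of_nat m) \<cdot>\<^sub>m A)"

definition MA_mat :: "nat \<Rightarrow> complex mat \<Rightarrow> complex mat" where
  "MA_mat m A =
     (let d = dim_row A in
      mat (m * d) (m * d) (\<lambda>(r, c). MA_block m A (r div d) (c div d) $$ (r mod d, c mod d)))"

definition MA_mat_scalar :: "nat \<Rightarrow> complex \<Rightarrow> complex mat" where
  "MA_mat_scalar m a = MA_mat m (mat 1 1 (\<lambda>_. a))"

definition MARS :: "nat \<Rightarrow> complex set" where
  "MARS m = {a. spectrum (MA_mat_scalar m a) \<subseteq> ball 0 1}"

end

theory Submission
  imports Defs
begin

text \<open>
  Stacking \<open>m\<close> consecutive iterates turns the moving-average recursion into the linear
  iteration with matrix \<open>MA_mat m A\<close>, so stability amounts to the powers of that matrix tending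
  to 0. An eigenvector of \<open>MA_mat m A\<close> for \<open>z\<close> has blocks \<open>w, z w, \<dots>, z\<^sup>m\<^sup>-\<^sup>1 w\<close> with
  \<open>z\<^sup>m w = s(z) A w\<close> and \<open>s(z) = (1 + z + \<dots> + z\<^sup>m\<^sup>-\<^sup>1) / m\<close>. Since \<open>z\<^sup>m\<close> and \<open>s(z)\<close> have no common
  zero, \<open>w\<close> is an eigenvector of \<open>A\<close>, for an eigenvalue \<open>a\<close> with \<open>z\<^sup>m = a s(z)\<close>. As the same
  equation describes the spectrum in the scalar case, the spectrum of \<open>MA_mat m A\<close> is the union of
  those of \<open>MA_mat_scalar m a\<close> over the eigenvalues \<open>a\<close> of \<open>A\<close>.
\<close>

section \<open>Vectors of length \<open>m * d\<close> as stacks of \<open>m\<close> blocks, and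
  averages of blocks\<close>

definition stack :: "nat \<Rightarrow> nat \<Rightarrow> (nat \<Rightarrow> 'a vec) \<Rightarrow> 'a vec" where
  "stack d m f = vec (m * d) (\<lambda>r. f (r div d) $ (r mod d))"

text \<open>Entrywise form of the average in \<open>moving_average\<close>: its dimension is
  \<open>d\<close> by construction, with no carrier conditions as for
  \<open>finsum_vec\<close>.\<close>

definition block_mean :: "nat \<Rightarrow> nat \<Rightarrow> (nat \<Rightarrow> complex vec) \<Rightarrow> complex vec" where
  "block_mean d m f = vec d (\<lambda>p. (\<Sum>j<m. f j $ p) / of_nat m)"

lemma block_index_less:
  fixes i p m d :: nat
  assumes "i < m" "p < d"
  shows "i * d + p < m * d"
proof -
  have "i * d + p < Suc i * d" using assms by simp
  also have "\<dots> \<le> m * d" using assms by (intro mult_le_mono1) simp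
  finally show ?thesis .
qed

lemma block_index_div_mod:
  fixes r m d :: nat
  assumes "r < m * d"
  shows "r div d < m" "r mod d < d"
proof -
  have "d > 0" using assms by (cases d) auto
  then show "r div d < m" "r mod d < d" using assms by (auto simp: less_mult_imp_div_less)
qed

lemma sum_blocks:
  fixes g :: "nat \<Rightarrow> 'a::comm_monoid_add"
  shows "(\<Sum>r<m * d. g r) = (\<Sum>j<m. \<Sum>q<d. g (j * d + q))"
proof -
  have "sum g {j * d..<j * d + d} = (\<Sum>q<d. g (j * d + q))" for j
    using sum.shift_bounds_nat_ivl[of g 0 "j * d" d]
    by (simp add: atLeast0LessThan add.commute)
  then show ?thesis by (simp add: sum.nat_group[symmetric])
qed

lemma stack_carrier [simp]: "stack d m f \<in> carrier_vec (m * d)"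
  by (simp add: stack_def)

lemma dim_stack [simp]: "dim_vec (stack d m f) = m * d"
  by (simp add: stack_def)

lemma stack_index [simp]:
  assumes "i < m" "p < d"
  shows "stack d m f $ (i * d + p) = f i $ p"
  using block_index_less[OF assms] assms by (simp add: stack_def)

lemma stack_eqI:
  assumes "v \<in> carrier_vec (m * d)"
    and "\<And>i p. i < m \<Longrightarrow> p < d \<Longrightarrow> v $ (i * d + p) = f i $ p"
  shows "v = stack d m f"
proof (rule eq_vecI)
  fix r assume "r < dim_vec (stack d m f)"
  then have r: "r < m * d" by simp
  show "v $ r = stack d m f $ r"
    using assms(2)[OF block_index_div_mod[OF r]] r by (simp add: stack_def)
qed (use assms in simp)

text \<open>Lets an equation between stacks be read block by block. The carrier assumptions exclude
  blocks that differ only outside their first \<open>d\<close> entries, which \<open>stack\<close>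
  never reads.\<close>

lemma stack_eq_iff:
  assumes "\<And>i. i < m \<Longrightarrow> f i \<in> carrier_vec d" "\<And>i. i < m \<Longrightarrow> g i \<in> carrier_vec d"
  shows "stack d m f = stack d m g \<longleftrightarrow> (\<forall>i<m. f i = g i)"
proof (intro iffI allI impI)
  fix i assume eq: "stack d m f = stack d m g" and i: "i < m"
  show "f i = g i"
  proof (rule eq_vecI)
    fix p assume "p < dim_vec (g i)"
    then have "p < d" using assms(2)[OF i] by simp
    then show "f i $ p = g i $ p" using i eq by (metis stack_index)
  next
    show "dim_vec (f i) = dim_vec (g i)" using assms i by (metis carrier_vecD)
  qed
qed (auto intro!: stack_eqI)

lemma smult_stack:
  assumes "\<And>i. i < m \<Longrightarrow> f i \<in> carrier_vec d"
  shows "c \<cdot>\<^sub>v stack d m f = stack d m (\<lambda>i. c \<cdot>\<^sub>v f i)"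
proof (rule stack_eqI)
  fix i p assume "i < m" "p < d"
  then show "(c \<cdot>\<^sub>v stack d m f) $ (i * d + p) = (c \<cdot>\<^sub>v f i) $ p"
    using assms block_index_less[of i m p d] by (metis carrier_vecD dim_stack index_smult_vec(1) stack_index)
qed simp

lemma stack_blocks:
  assumes "v \<in> carrier_vec (m * d)"
  shows "v = stack d m (\<lambda>i. vec d (\<lambda>p. v $ (i * d + p)))"
  using assms by (intro stack_eqI) auto

lemma block_mean_carrier [simp]: "block_mean d m f \<in> carrier_vec d"
  by (simp add: block_mean_def)

text \<open>The average runs backwards from \<open>k\<close>. Reversing it lists the window from its
  oldest index \<open>k - (m - 1)\<close>, the order used in stacks; \<open>k \<ge> m - 1\<close>
  keeps this subtraction from being truncated.\<close>

lemma moving_average_eq_block_mean: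
  assumes x: "\<And>k. x k \<in> carrier_vec d" and k: "k \<ge> m - 1" and m: "m \<ge> 1"
  shows "moving_average d m x k = block_mean d m (\<lambda>i. x (k - (m - 1) + i))"
proof (rule eq_vecI)
  fix p assume "p < dim_vec (block_mean d m (\<lambda>i. x (k - (m - 1) + i)))"
  then have p: "p < d" by (simp add: block_mean_def)
  have dim: "dim_vec (finsum_vec TYPE(complex) d (\<lambda>l. x (k - l)) {..<m}) = d"
    using finsum_vec_closed[of "\<lambda>l. x (k - l)" "{..<m}" d] x by auto
  have "(\<Sum>l<m. x (k - l) $ p) = (\<Sum>i<m. x (k - (m - Suc i)) $ p)"
    by (rule sum.nat_diff_reindex[symmetric])
  also have "\<dots> = (\<Sum>i<m. x (k - (m - 1) + i) $ p)"
    using k by (intro sum.cong refl arg_cong[where f = "\<lambda>n. x n $ p"]) auto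
  finally show "moving_average d m x k $ p = block_mean d m (\<lambda>i. x (k - (m - 1) + i)) $ p"
    using p x dim by (simp add: moving_average_def block_mean_def index_finsum_vec)
next
  show "dim_vec (moving_average d m x k) = dim_vec (block_mean d m (\<lambda>i. x (k - (m - 1) + i)))"
    using finsum_vec_closed[of "\<lambda>l. x (k - l)" "{..<m}" d] x
    by (auto simp: moving_average_def block_mean_def)
qed

section \<open>The action of \<open>MA_mat\<close> on stacked vectors\<close>

lemma MA_mat_carrier [simp]:
  assumes "A \<in> carrier_mat d d"
  shows "MA_mat m A \<in> carrier_mat (m * d) (m * d)"
  using assms by (simp add: MA_mat_def Let_def)

lemma MA_mat_index:
  assumes A: "A \<in> carrier_mat d d" and "i < m" "p < d" "j < m" "q < d"
  shows "MA_mat m A $$ (i * d + p, j * d + q) =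
    (if i < m - 1 then (if j = Suc i \<and> p = q then 1 else 0) else A $$ (p, q) / of_nat m)"
  using assms block_index_less[of i m p d] block_index_less[of j m q d]
  by (auto simp: MA_mat_def MA_block_def Let_def)

text \<open>One step of the recursion: the window drops its oldest block, moves up, and gains the
  new value. Both the eigenvalue equation and the iteration are read off from this.\<close>

lemma MA_mat_mult_stack:
  assumes A: "A \<in> carrier_mat d d" and f: "\<And>i. i < m \<Longrightarrow> f i \<in> carrier_vec d"
  shows "MA_mat m A *\<^sub>v stack d m f =
    stack d m (\<lambda>i. if i < m - 1 then f (Suc i) else A *\<^sub>v block_mean d m f)"
proof (rule stack_eqI)
  show "MA_mat m A *\<^sub>v stack d m f \<in> carrier_vec (m * d)"
    using MA_mat_carrier[OF A] by (metis mult_mat_vec_carrier stack_carrier)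
next
  fix i p assume i: "i < m" and p: "p < d"
  let ?M = "MA_mat m A"
  have M: "dim_row ?M = m * d" "dim_col ?M = m * d" using MA_mat_carrier[OF A] by auto
  have "(?M *\<^sub>v stack d m f) $ (i * d + p)
      = (\<Sum>r<m * d. ?M $$ (i * d + p, r) * stack d m f $ r)"
    using M block_index_less[OF i p]
    by (simp add: scalar_prod_def atLeast0LessThan)
  also have "\<dots> = (\<Sum>j<m. \<Sum>q<d. ?M $$ (i * d + p, j * d + q) * f j $ q)"
    by (simp add: sum_blocks)
  also have "\<dots> = (if i < m - 1 then f (Suc i) else A *\<^sub>v block_mean d m f) $ p"
  proof (cases "i < m - 1")
    case True
    have "(\<Sum>j<m. \<Sum>q<d. ?M $$ (i * d + p, j * d + q) * f j $ q)
        = (\<Sum>j<m. if j = Suc i then f (Suc i) $ p else 0)"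
    proof (rule sum.cong[OF refl])
      fix j assume j: "j \<in> {..<m}"
      have "(\<Sum>q<d. ?M $$ (i * d + p, j * d + q) * f j $ q)
          = (\<Sum>q<d. if q = p then (if j = Suc i then f (Suc i) $ p else 0) else 0)"
        using True j by (intro sum.cong refl) (auto simp: MA_mat_index[OF A i p])
      then show "(\<Sum>q<d. ?M $$ (i * d + p, j * d + q) * f j $ q) = (if j = Suc i then f (Suc i) $ p else 0)"
        using p by simp
    qed
    then show ?thesis using True by simp
  next
    case False
    have "(\<Sum>j<m. \<Sum>q<d. ?M $$ (i * d + p, j * d + q) * f j $ q)
        = (\<Sum>j<m. \<Sum>q<d. A $$ (p, q) / of_nat m * f j $ q)"
      using False by (intro sum.cong refl) (auto simp: MA_mat_index[OF A i p])
    also have "\<dots> = (\<Sum>q<d. A $$ (p, q) * ((\<Sum>j<m. f j $ q) / of_nat m))"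
      by (subst sum.swap) (simp add: sum_distrib_left sum_divide_distrib)
    also have "\<dots> = (A *\<^sub>v block_mean d m f) $ p"
      using A p by (simp add: scalar_prod_def block_mean_def atLeast0LessThan)
    finally show ?thesis using False by simp
  qed
  finally show "(?M *\<^sub>v stack d m f) $ (i * d + p)
    = (if i < m - 1 then f (Suc i) else A *\<^sub>v block_mean d m f) $ p" .
qed

section \<open>Eigenvalues and eigenvectors of \<open>MA_mat\<close>\<close>

definition power_mean :: "nat \<Rightarrow> complex \<Rightarrow> complex" where
  "power_mean m z = (\<Sum>j<m. z ^ j) / of_nat m"

text \<open>The factor \<open>c\<close> allows a window anywhere in the geometric sequence:
  \<open>c = 1\<close> serves the eigenvectors, \<open>c = z ^ n\<close> the window of a trajectory
  that starts at index \<open>n\<close>.\<close>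

lemma block_mean_geometric:
  assumes "w \<in> carrier_vec d"
  shows "block_mean d m (\<lambda>i. (c * z ^ i) \<cdot>\<^sub>v w) = (c * power_mean m z) \<cdot>\<^sub>v w"
  using assms
  by (intro eq_vecI)
    (auto simp: block_mean_def power_mean_def sum_distrib_left sum_distrib_right intro!: sum.cong)

text \<open>The relation is kept undivided because in this form it says that the sequence of the
  vectors \<open>z ^ k \<cdot>\<^sub>v w\<close> solves the recursion, which is how instability is
  detected later.\<close>

lemma eigenvalue_MA_matD:
  assumes A: "A \<in> carrier_mat d d" and m: "m \<ge> 1" and ev: "eigenvalue (MA_mat m A) z"
  shows "\<exists>w \<in> carrier_vec d. w \<noteq> 0\<^sub>v d \<and> z ^ m \<cdot>\<^sub>v w = power_mean m z \<cdot>\<^sub>v (A *\<^sub>v w)"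
proof -
  let ?M = "MA_mat m A"
  obtain v where v: "v \<in> carrier_vec (m * d)" "v \<noteq> 0\<^sub>v (m * d)" "?M *\<^sub>v v = z \<cdot>\<^sub>v v"
    using ev MA_mat_carrier[OF A] unfolding eigenvalue_def eigenvector_def by (metis carrier_matD(1))
  define f where "f i = vec d (\<lambda>p. v $ (i * d + p))" for i
  have f: "f i \<in> carrier_vec d" for i by (simp add: f_def)
  have vf: "v = stack d m f" unfolding f_def by (rule stack_blocks[OF v(1)])
  have Af: "A *\<^sub>v block_mean d m f \<in> carrier_vec d"
    using A by (metis block_mean_carrier mult_mat_vec_carrier)
  have "stack d m (\<lambda>i. if i < m - 1 then f (Suc i) else A *\<^sub>v block_mean d m f)
      = stack d m (\<lambda>i. z \<cdot>\<^sub>v f i)"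
    using v(3) f by (simp add: vf MA_mat_mult_stack[OF A] smult_stack)
  \<comment> \<open>The rows before the last make the blocks a geometric sequence; the last row
    yields the relation for \<open>w\<close>.\<close>
  then have eqs: "(if i < m - 1 then f (Suc i) else A *\<^sub>v block_mean d m f) = z \<cdot>\<^sub>v f i"
    if "i < m" for i
    using that f Af by (subst (asm) stack_eq_iff) auto
  define w where "w = f 0"
  have w: "w \<in> carrier_vec d" using f by (simp add: w_def)
  have pow: "f i = z ^ i \<cdot>\<^sub>v w" if "i < m" for i
    using that
  proof (induction i)
    case (Suc i)
    then have "i < m - 1" by simp
    then show ?case using Suc eqs[of i] by (simp add: smult_smult_assoc)
  qed (simp add: w_def)
  have "block_mean d m f = block_mean d m (\<lambda>i. (1 * z ^ i) \<cdot>\<^sub>v w)"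
    unfolding block_mean_def using pow by (intro eq_vecI) auto
  also have "\<dots> = power_mean m z \<cdot>\<^sub>v w" by (subst block_mean_geometric[OF w]) simp
  finally have "power_mean m z \<cdot>\<^sub>v (A *\<^sub>v w) = z \<cdot>\<^sub>v f (m - 1)"
    using eqs[of "m - 1"] m A w by (simp add: mult_mat_vec)
  also have "\<dots> = z ^ m \<cdot>\<^sub>v w"
    using pow[of "m - 1"] m by (simp add: smult_smult_assoc power_eq_if)
  finally have "z ^ m \<cdot>\<^sub>v w = power_mean m z \<cdot>\<^sub>v (A *\<^sub>v w)" ..
  \<comment> \<open>All blocks are multiples of \<open>w\<close>, so \<open>w = 0\<close> would make
    the whole eigenvector zero.\<close>
  moreover have "w \<noteq> 0\<^sub>v d"
  proof
    assume "w = 0\<^sub>v d"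
    then have "v = 0\<^sub>v (m * d)"
      using pow by (subst vf, intro stack_eqI[symmetric]) (auto simp: block_index_less)
    with v(2) show False by simp
  qed
  ultimately show ?thesis using w by blast
qed

text \<open>A geometric stack satisfies the shift rows automatically; the assumption on
  \<open>w\<close> is exactly what the last block row demands.\<close>

lemma MA_mat_geometric_eigenvector:
  assumes A: "A \<in> carrier_mat d d" and m: "m \<ge> 1"
    and w: "w \<in> carrier_vec d" "w \<noteq> 0\<^sub>v d" and eq: "z ^ m \<cdot>\<^sub>v w = power_mean m z \<cdot>\<^sub>v (A *\<^sub>v w)"
  shows "eigenvector (MA_mat m A) (stack d m (\<lambda>i. z ^ i \<cdot>\<^sub>v w)) z"
proof -
  let ?M = "MA_mat m A" and ?f = "\<lambda>i. z ^ i \<cdot>\<^sub>v w"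
  have "A *\<^sub>v block_mean d m ?f = z ^ m \<cdot>\<^sub>v w"
    using block_mean_geometric[OF w(1), of m 1 z] eq A w by (simp add: mult_mat_vec)
  also have "\<dots> = z \<cdot>\<^sub>v ?f (m - 1)" using m by (simp add: smult_smult_assoc power_eq_if)
  finally have last: "A *\<^sub>v block_mean d m ?f = z \<cdot>\<^sub>v ?f (m - 1)" .
  have "?M *\<^sub>v stack d m ?f
      = stack d m (\<lambda>i. if i < m - 1 then ?f (Suc i) else A *\<^sub>v block_mean d m ?f)"
    using w by (intro MA_mat_mult_stack[OF A]) auto
  also have "\<dots> = stack d m (\<lambda>i. z \<cdot>\<^sub>v ?f i)"
  proof (subst stack_eq_iff; (intro allI impI)?)
    fix i assume "i < m"
    then show "(if i < m - 1 then ?f (Suc i) else A *\<^sub>v block_mean d m ?f) = z \<cdot>\<^sub>v ?f i"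
      using last by (cases "i < m - 1") (auto simp: smult_smult_assoc dest: not_less_less_Suc_eq)
  qed (use w last in auto)
  also have "\<dots> = z \<cdot>\<^sub>v stack d m ?f" using w by (simp add: smult_stack)
  finally have "?M *\<^sub>v stack d m ?f = z \<cdot>\<^sub>v stack d m ?f" .
  moreover have "stack d m ?f \<noteq> 0\<^sub>v (m * d)"
  proof
    assume 0: "stack d m ?f = 0\<^sub>v (m * d)"
    \<comment> \<open>Block 0 is \<open>z ^ 0 \<cdot>\<^sub>v w\<close>, hence \<open>w\<close>
      itself even when \<open>z = 0\<close>.\<close>
    have "w $ p = 0" if "p < d" for p
      using stack_index[of 0 m p d ?f] block_index_less[of 0 m p d] 0 m w that by simp
    then show False using w by (metis carrier_vecD eq_vecI index_zero_vec)
  qed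
  ultimately show ?thesis using MA_mat_carrier[OF A, of m] by (simp add: eigenvector_def)
qed

lemma eigenvalue_MA_mat_iff:
  assumes A: "A \<in> carrier_mat d d" and m: "m \<ge> 1"
  shows "eigenvalue (MA_mat m A) z \<longleftrightarrow> (\<exists>a. eigenvalue A a \<and> z ^ m = power_mean m z * a)"
proof
  assume "eigenvalue (MA_mat m A) z"
  from eigenvalue_MA_matD[OF A m this] obtain w where w: "w \<in> carrier_vec d" "w \<noteq> 0\<^sub>v d"
    and eq: "z ^ m \<cdot>\<^sub>v w = power_mean m z \<cdot>\<^sub>v (A *\<^sub>v w)" by blast
  obtain p where p: "p < d" "w $ p \<noteq> 0"
    using w by (metis carrier_vecD eq_vecI index_zero_vec)
  have comp: "z ^ m * w $ q = power_mean m z * (A *\<^sub>v w) $ q" if "q < d" for q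
    using arg_cong[OF eq, of "\<lambda>u. u $ q"] that A w by simp
  \<comment> \<open>If the mean vanished, a nonzero entry of \<open>w\<close> would force
    \<open>z ^ m = 0\<close>, so \<open>z = 0\<close>; but the mean at 0 is \<open>1 / m\<close>,
    because the term \<open>0 ^ 0\<close> equals 1.\<close>
  have s: "power_mean m z \<noteq> 0"
  proof
    assume s: "power_mean m z = 0"
    then have "z = 0" using comp[OF p(1)] p(2) by simp
    moreover have "(\<Sum>j<m. (0::complex) ^ j) = 1" using m by (cases m) (simp_all add: sum.lessThan_Suc_shift del: sum.lessThan_Suc)
    ultimately show False using s m by (simp add: power_mean_def)
  qed
  have "A *\<^sub>v w = (z ^ m / power_mean m z) \<cdot>\<^sub>v w"
    using comp s A w by (intro eq_vecI) (auto simp: field_simps)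
  then have "eigenvalue A (z ^ m / power_mean m z)"
    using A w unfolding eigenvalue_def eigenvector_def by auto
  then show "\<exists>a. eigenvalue A a \<and> z ^ m = power_mean m z * a"
    using s by (intro exI[of _ "z ^ m / power_mean m z"]) simp
next
  assume "\<exists>a. eigenvalue A a \<and> z ^ m = power_mean m z * a"
  then obtain a w where w: "w \<in> carrier_vec d" "w \<noteq> 0\<^sub>v d" "A *\<^sub>v w = a \<cdot>\<^sub>v w"
    and z: "z ^ m = power_mean m z * a"
    using A unfolding eigenvalue_def eigenvector_def by auto
  have "z ^ m \<cdot>\<^sub>v w = power_mean m z \<cdot>\<^sub>v (A *\<^sub>v w)" using w(3) z by (simp add: smult_smult_assoc)
  from MA_mat_geometric_eigenvector[OF A m w(1,2) this]
  show "eigenvalue (MA_mat m A) z" unfolding eigenvalue_def by blast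
qed

lemma eigenvalue_mat_1_1: "eigenvalue (mat 1 1 (\<lambda>_. a)) b \<longleftrightarrow> b = (a :: complex)"
proof
  assume "eigenvalue (mat 1 1 (\<lambda>_. a)) b"
  then obtain v where v: "v \<in> carrier_vec 1" "v \<noteq> 0\<^sub>v 1" "mat 1 1 (\<lambda>_. a) *\<^sub>v v = b \<cdot>\<^sub>v v"
    unfolding eigenvalue_def eigenvector_def by auto
  have "v $ 0 \<noteq> 0" using v by (auto intro!: eq_vecI)
  moreover have "a * v $ 0 = b * v $ 0"
    using arg_cong[OF v(3), of "\<lambda>u. u $ 0"] v(1) by (simp add: scalar_prod_def)
  ultimately show "b = a" by simp
next
  assume "b = a"
  have "eigenvector (mat 1 1 (\<lambda>_. a)) (vec 1 (\<lambda>_. 1)) a"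
    by (auto simp: eigenvector_def scalar_prod_def vec_eq_iff)
  with \<open>b = a\<close> show "eigenvalue (mat 1 1 (\<lambda>_. a)) b" unfolding eigenvalue_def by blast
qed

text \<open>Reduces the equivalence of (ii) and (iii) to the fact that a union lies in the ball iff
  each of its members does.\<close>

lemma spectrum_MA_mat:
  assumes A: "A \<in> carrier_mat d d" and m: "m \<ge> 1"
  shows "spectrum (MA_mat m A) = (\<Union>a \<in> spectrum A. spectrum (MA_mat_scalar m a))"
proof -
  have "eigenvalue (MA_mat_scalar m a) z \<longleftrightarrow> z ^ m = power_mean m z * a" for a z
    unfolding MA_mat_scalar_def
    by (subst eigenvalue_MA_mat_iff[OF _ m, of _ 1]) (simp_all only: eigenvalue_mat_1_1 mat_carrier, auto)
  then show ?thesis by (auto simp: spectrum_def eigenvalue_MA_mat_iff[OF A m])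
qed

section \<open>Decay of matrix powers, and convergence of vectors by entries\<close>

lemma pow_mat_smult:
  fixes A :: "'a::comm_semiring_1 mat"
  assumes A: "A \<in> carrier_mat n n"
  shows "(c \<cdot>\<^sub>m A) ^\<^sub>m k = c ^ k \<cdot>\<^sub>m A ^\<^sub>m k"
proof (induction k)
  case (Suc k)
  have "A ^\<^sub>m k \<in> carrier_mat n n" using A by simp
  then show ?case using Suc A
    by (simp add: mult_smult_assoc_mat[of _ n n] mult_smult_distrib[of _ n n])
      (auto intro!: eq_matI simp: ac_simps)
qed (use A in \<open>auto intro!: eq_matI\<close>)

text \<open>The decay is geometric: for \<open>r\<close> strictly between the spectral radius and 1,
  the entries of the powers are bounded by \<open>K * r ^ k\<close>.\<close>

lemma pow_mat_entry_tendsto_0: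
  fixes A :: "complex mat"
  assumes A: "A \<in> carrier_mat n n" and sp: "spectrum A \<subseteq> ball 0 1" and ij: "i < n" "j < n"
  shows "(\<lambda>k. (A ^\<^sub>m k) $$ (i, j)) \<longlonglongrightarrow> 0"
proof -
  have n: "n > 0" using ij by simp
  from spectral_radius_mem_max(1)[OF A n] sp have sr: "spectral_radius A < 1" by auto
  have sr0: "spectral_radius A \<ge> 0" using spectral_radius_mem_max(1)[OF A n] by auto
  obtain r where r: "spectral_radius A < r" "r < 1" using sr dense by blast
  then have r0: "r > 0" using sr0 by simp
  \<comment> \<open>The available theorem only bounds the powers, so it is applied to \<open>A\<close> scaled by \<open>1 / r\<close>.\<close>
  define c :: complex where "c = of_real (1 / r)"
  define B where "B = c \<cdot>\<^sub>m A"
  have B: "B \<in> carrier_mat n n" using A by (simp add: B_def)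
  have c0: "c \<noteq> 0" using r0 by (simp add: c_def)
  \<comment> \<open>Let \<open>b\<close> be an eigenvalue of \<open>B\<close> of maximal modulus.
    Then \<open>b / c\<close> is an eigenvalue of \<open>A\<close>, so \<open>norm b * r\<close> is
    at most the spectral radius of \<open>A\<close>, which is below \<open>r\<close>; hence
    \<open>norm b < 1\<close>.\<close>
  have "spectral_radius B \<in> norm ` spectrum B" using spectral_radius_mem_max(1)[OF B n] .
  then obtain b v where b: "norm b = spectral_radius B" and v: "v \<in> carrier_vec n" "v \<noteq> 0\<^sub>v n"
    "B *\<^sub>v v = b \<cdot>\<^sub>v v"
    using B by (auto simp: spectrum_def eigenvalue_def eigenvector_def)
  have "c \<cdot>\<^sub>v (A *\<^sub>v v) = b \<cdot>\<^sub>v v"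
  proof (rule eq_vecI)
    fix i assume "i < dim_vec (b \<cdot>\<^sub>v v)"
    then show "(c \<cdot>\<^sub>v (A *\<^sub>v v)) $ i = (b \<cdot>\<^sub>v v) $ i"
      using arg_cong[OF v(3), of "\<lambda>u. u $ i"] v(1) A by (simp add: B_def)
  qed (use v(1) A in simp)
  then have "inverse c \<cdot>\<^sub>v (c \<cdot>\<^sub>v (A *\<^sub>v v)) = (b / c) \<cdot>\<^sub>v v"
    by (simp add: smult_smult_assoc field_simps)
  then have "A *\<^sub>v v = (b / c) \<cdot>\<^sub>v v" using c0 by (simp add: smult_smult_assoc)
  then have "b / c \<in> spectrum A"
    using v A by (auto simp: spectrum_def eigenvalue_def eigenvector_def)
  then have "norm (b / c) \<le> spectral_radius A" using spectral_radius_mem_max(2)[OF A n] by blast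
  then have "norm b * r \<le> spectral_radius A" using r0 by (simp add: c_def norm_mult)
  then have "spectral_radius B < 1" using b r r0
    by (smt (verit, ccfv_threshold) mult_le_cancel_right1)
  from spectral_radius_jnf_norm_bound_less_1_upper_triangular[OF B this]
  obtain K where K: "norm_bound (B ^\<^sub>m k) K" for k by blast
  have bound: "norm ((A ^\<^sub>m k) $$ (i, j)) \<le> K * r ^ k" for k
  proof -
    have "norm ((B ^\<^sub>m k) $$ (i, j)) \<le> K"
      using K[of k] ij B by (simp add: norm_bound_def)
    then have "norm (c ^ k * (A ^\<^sub>m k) $$ (i, j)) \<le> K"
      using ij A by (simp add: B_def pow_mat_smult[OF A])
    then show ?thesis using r0 by (simp add: c_def norm_mult norm_power norm_divide field_simps)
  qed
  have "(\<lambda>k. K * r ^ k) \<longlonglongrightarrow> 0"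
    using r r0 by (intro tendsto_mult_right_zero LIMSEQ_realpow_zero) auto
  then show ?thesis
  proof (rule tendsto_0_le[where K = 1])
    have "norm ((A ^\<^sub>m k) $$ (i, j)) \<le> norm (K * r ^ k) * 1" for k
      using bound[of k] by simp
    then show "\<forall>\<^sub>F k in sequentially. norm ((A ^\<^sub>m k) $$ (i, j)) \<le> norm (K * r ^ k) * 1"
      by simp
  qed
qed

lemma pow_mat_mult_vec_tendsto_0:
  fixes A :: "complex mat"
  assumes A: "A \<in> carrier_mat n n" and sp: "spectrum A \<subseteq> ball 0 1"
    and v: "v \<in> carrier_vec n" and i: "i < n"
  shows "(\<lambda>k. (A ^\<^sub>m k *\<^sub>v v) $ i) \<longlonglongrightarrow> 0"
proof -
  have "(A ^\<^sub>m k *\<^sub>v v) $ i = (\<Sum>j<n. (A ^\<^sub>m k) $$ (i, j) * v $ j)" for k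
    using A v i by (simp add: scalar_prod_def atLeast0LessThan)
  moreover have "(\<lambda>k. \<Sum>j<n. (A ^\<^sub>m k) $$ (i, j) * v $ j) \<longlonglongrightarrow> 0"
    using i by (intro tendsto_null_sum tendsto_mult_left_zero pow_mat_entry_tendsto_0[OF A sp]) auto
  ultimately show ?thesis by simp
qed

text \<open>The Euclidean norm lies between the modulus of any single entry and the sum of all the
  moduli.\<close>

lemma vec_converges_to_zero_iff:
  assumes x: "\<And>k. x k \<in> carrier_vec d"
  shows "vec_converges_to_zero x \<longleftrightarrow> (\<forall>p<d. (\<lambda>k. x k $ p) \<longlonglongrightarrow> 0)"
proof -
  have dim: "dim_vec (x k) = d" for k using x by simp
  show ?thesis
  proof (intro iffI allI impI)
    fix p assume conv: "vec_converges_to_zero x" and p: "p < d"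
    have "norm (x k $ p) \<le> L2_set (\<lambda>i. norm (x k $ i)) {..<d}" for k
      using p by (intro member_le_L2_set) auto
    with conv show "(\<lambda>k. x k $ p) \<longlonglongrightarrow> 0"
      unfolding vec_converges_to_zero_def dim
      by (elim tendsto_0_le[where K = 1]) (auto simp: L2_set_nonneg)
  next
    assume "\<forall>p<d. (\<lambda>k. x k $ p) \<longlonglongrightarrow> 0"
    then have "(\<lambda>k. \<Sum>i<d. norm (x k $ i)) \<longlonglongrightarrow> 0"
      by (intro tendsto_null_sum tendsto_norm_zero) auto
    then show "vec_converges_to_zero x"
      unfolding vec_converges_to_zero_def dim
      by (elim tendsto_0_le[where K = 1])
        (auto intro!: always_eventually L2_set_le_sum simp: L2_set_nonneg sum_nonneg)
  qed
qed

section \<open>Stability of the recursion and the spectrum of \<open>MA_mat\<close>\<close>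

lemma moving_average_stableI:
  assumes A: "A \<in> carrier_mat d d" and m: "m \<ge> 1" and sp: "spectrum (MA_mat m A) \<subseteq> ball 0 1"
  shows "moving_average_stable m A"
  unfolding moving_average_stable_def
proof (intro allI impI)
  fix x assume "\<forall>k. x k \<in> carrier_vec (dim_row A)"
    and "\<exists>k0\<ge>m - 1. \<forall>k\<ge>k0. x (k + 1) = A *\<^sub>v moving_average (dim_row A) m x k"
  then obtain k0 where x: "x k \<in> carrier_vec d"
    and rec: "k \<ge> k0 \<Longrightarrow> x (k + 1) = A *\<^sub>v moving_average d m x k" and k0: "k0 \<ge> m - 1" for k
    using A by auto
  let ?M = "MA_mat m A"
  note M = MA_mat_carrier[OF A, of m]
  \<comment> \<open>The windows start, rather than end, at \<open>k0 + n\<close>. The recursion is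
    applied at their last index \<open>k0 + n + (m - 1)\<close>, which is at least both
    \<open>k0\<close> and \<open>m - 1\<close>.\<close>
  define X where "X n = stack d m (\<lambda>i. x (k0 + n + i))" for n
  have step: "X (Suc n) = ?M *\<^sub>v X n" for n
  proof -
    have last: "A *\<^sub>v block_mean d m (\<lambda>i. x (k0 + n + i)) = x (k0 + n + m)"
      using rec[of "k0 + n + (m - 1)"] m
      by (simp add: moving_average_eq_block_mean[OF x] add.assoc)
    have "?M *\<^sub>v X n = stack d m (\<lambda>i. if i < m - 1 then x (k0 + n + Suc i) else x (k0 + n + m))"
      unfolding X_def MA_mat_mult_stack[OF A x] last ..
    also have "\<dots> = X (Suc n)"
    proof -
      have "(if i < m - 1 then x (k0 + n + Suc i) else x (k0 + n + m)) = x (k0 + Suc n + i)"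
        if "i < m" for i
      proof (cases "i < m - 1")
        case False
        then have "m = Suc i" using that by simp
        then show ?thesis by simp
      qed simp
      then show ?thesis unfolding X_def using x by (subst stack_eq_iff) auto
    qed
    finally show ?thesis ..
  qed
  have X: "X n \<in> carrier_vec (m * d)" for n by (simp add: X_def)
  \<comment> \<open>The start \<open>n\<close> stays arbitrary because
    \<open>?M ^\<^sub>m Suc k\<close> unfolds to \<open>?M ^\<^sub>m k * ?M\<close>: the induction
    splits off the earliest step and continues from \<open>Suc n\<close>.\<close>
  have pow: "X (n + k) = ?M ^\<^sub>m k *\<^sub>v X n" for n k
  proof (induction k arbitrary: n)
    case 0
    show ?case using X[of n] M by simp
  next
    case (Suc k)
    have "X (n + Suc k) = ?M ^\<^sub>m k *\<^sub>v (?M *\<^sub>v X n)" using Suc[of "Suc n"] step by simp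
    also have "\<dots> = ?M ^\<^sub>m Suc k *\<^sub>v X n"
      using M X[of n] by (simp add: assoc_mult_mat_vec[of _ "m * d" "m * d" _ "m * d"])
    finally show ?case .
  qed
  have "(\<lambda>k. x k $ p) \<longlonglongrightarrow> 0" if p: "p < d" for p
  proof -
    \<comment> \<open>The first block of \<open>X k\<close> is \<open>x (k0 + k)\<close>, so
      following this block alone recovers the sequence.\<close>
    have "x (k + k0) $ p = (?M ^\<^sub>m k *\<^sub>v X 0) $ p" for k
      using stack_index[of 0 m p d "\<lambda>i. x (k0 + k + i)"] m p pow[of 0 k]
      by (simp add: X_def add.commute)
    moreover have "p < m * d" using block_index_less[of 0 m p d] m p by simp
    ultimately have "(\<lambda>k. x (k + k0) $ p) \<longlonglongrightarrow> 0"
      using pow_mat_mult_vec_tendsto_0[OF M sp X] by simp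
    then show ?thesis by (rule LIMSEQ_offset)
  qed
  then show "vec_converges_to_zero x" by (simp add: vec_converges_to_zero_iff[OF x])
qed

text \<open>An eigenvalue \<open>z\<close> gives the trajectory
  \<open>z ^ k \<cdot>\<^sub>v w\<close> with \<open>w\<close> nonzero; stability makes it tend to
  0, which forces \<open>norm z < 1\<close>.\<close>

lemma moving_average_stableD:
  assumes A: "A \<in> carrier_mat d d" and m: "m \<ge> 1" and stab: "moving_average_stable m A"
  shows "spectrum (MA_mat m A) \<subseteq> ball 0 1"
proof
  fix z assume "z \<in> spectrum (MA_mat m A)"
  then have "eigenvalue (MA_mat m A) z" by (simp add: spectrum_def)
  from eigenvalue_MA_matD[OF A m this] obtain w where w: "w \<in> carrier_vec d" "w \<noteq> 0\<^sub>v d"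
    and eq: "z ^ m \<cdot>\<^sub>v w = power_mean m z \<cdot>\<^sub>v (A *\<^sub>v w)" by blast
  define x where "x k = z ^ k \<cdot>\<^sub>v w" for k
  have x: "x k \<in> carrier_vec d" for k using w by (simp add: x_def)
  have "x (k + 1) = A *\<^sub>v moving_average d m x k" if k: "k \<ge> m - 1" for k
  proof -
    \<comment> \<open>The window ending at \<open>k\<close> starts at \<open>n\<close>, so its
      average carries the factor \<open>z ^ n\<close>, and the next index is
      \<open>n + m\<close>.\<close>
    define n where "n = k - (m - 1)"
    have n: "k + 1 = n + m" using k m by (simp add: n_def)
    have "moving_average d m x k = (z ^ n * power_mean m z) \<cdot>\<^sub>v w"
      using block_mean_geometric[OF w(1), of m "z ^ n" z]
      by (simp add: moving_average_eq_block_mean[OF x k m] x_def n_def power_add)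
    then have "A *\<^sub>v moving_average d m x k = z ^ n \<cdot>\<^sub>v (power_mean m z \<cdot>\<^sub>v (A *\<^sub>v w))"
      using A w by (simp add: mult_mat_vec smult_smult_assoc)
    also have "\<dots> = x (k + 1)" unfolding eq[symmetric] n by (simp add: x_def smult_smult_assoc power_add)
    finally show ?thesis ..
  qed
  then have "vec_converges_to_zero x"
    using stab x A unfolding moving_average_stable_def by auto
  moreover obtain p where p: "p < d" "w $ p \<noteq> 0"
    using w by (metis carrier_vecD eq_vecI index_zero_vec)
  ultimately have "(\<lambda>k. x k $ p) \<longlonglongrightarrow> 0" by (simp add: vec_converges_to_zero_iff[OF x])
  then have "(\<lambda>k. z ^ k * w $ p) \<longlonglongrightarrow> 0" using w p by (simp add: x_def)
  then have "(\<lambda>k. z ^ k * w $ p / w $ p) \<longlonglongrightarrow> 0" by (rule tendsto_divide_zero)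
  then have "(\<lambda>k. z ^ k) \<longlonglongrightarrow> 0" using p by simp
  then have lim: "(\<lambda>k. norm z ^ k) \<longlonglongrightarrow> 0" by (simp add: tendsto_norm_zero flip: norm_power)
  have "norm z < 1"
  proof (rule ccontr)
    assume "\<not> norm z < 1"
    then have "1 \<le> norm z ^ k" for k by (simp add: one_le_power)
    then have "(1::real) \<le> 0" by (intro LIMSEQ_le_const[OF lim]) auto
    then show False by simp
  qed
  then show "z \<in> ball 0 1" by simp
qed

theorem theorem6p2:
  fixes A :: "complex mat" and d m :: nat
  assumes "A \<in> carrier_mat d d" and "m \<ge> 1"
  shows "(moving_average_stable m A \<longleftrightarrow> spectrum (MA_mat m A) \<subseteq> ball 0 1) \<and>
         (spectrum (MA_mat m A) \<subseteq> ball 0 1 \<longleftrightarrow> spectrum A \<subseteq> MARS m)"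
proof
  show "moving_average_stable m A \<longleftrightarrow> spectrum (MA_mat m A) \<subseteq> ball 0 1"
    using moving_average_stableI[OF assms] moving_average_stableD[OF assms] by blast
  show "spectrum (MA_mat m A) \<subseteq> ball 0 1 \<longleftrightarrow> spectrum A \<subseteq> MARS m"
    unfolding spectrum_MA_mat[OF assms] MARS_def by blast
qed

end
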